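(* Let $\lambda\in\mathbf{k}$, let $(A,P)$ be a Rota-Baxter algebra of weight $\lambda$, and let $(M,Q)$ be a bimodule over it. Put $R=\lambda\,\mathrm{id}_A+2P$ and $S=\lambda\,\mathrm{id}_M+2Q$, so that $(A,R)$ is a modified Rota-Baxter algebra of weight $\kappa=-\lambda^2$ and $(M,S)$ is a bimodule over $(A,R)$. Then the cohomology of the Rota-Baxter algebra $(A,P)$ with coefficients in $(M,Q)$ is isomorphic to the cohomology of the modified Rota-Baxter algebra $(A,R)$ with coefficients in $(M,S)$, i.e. $H^n_{\mathrm{RBA}}((A,P),(M,Q))\cong H^n_{\mathrm{mRBA}}((A,R),(M,S))$ for all $n\ge 0$.
   Context: Everything is over a field $\mathbf{k}$ of characteristic $0$; algebras are associative (not necessarily unital). Hochschild complex: for an algebra $B$ and a $B$-bimodule $N$, $C^n(B,N)=\mathrm{Hom}(B^{\otimes n},N)$ ($C^0=N$) and $\delta_{\mathrm{Hoch}}:C^n(B,N)\to C^{n+1}(B,N)$ is $(\delta_{\mathrm{Hoch}}f)(b_1,\dots,b_{n+1})=(-1)^{n+1}b_1\cdot f(b_2,\dots,b_{n+1})+f(b_1,\dots,b_n)\cdot b_{n+1}+\sum_{i=1}^n(-1)^{i+n+1}f(b_1,\dots,b_ib_{i+1},\dots,b_{n+1})$. Rota-Baxter side. $(A,P)$ is a Rota-Baxter algebra of weight $\lambda$ if $P:A\to A$ is linear and $P(a)P(b)=P(P(a)b+aP(b))+\lambda P(ab)$. A bimodule $(M,Q)$ over it is an $A$-bimodule $M$ with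 a linear map $Q:M\to M$ such that $P(a)\cdot Q(u)=Q(P(a)\cdot u+a\cdot Q(u))+\lambda Q(a\cdot u)$ and $Q(u)\cdot P(a)=Q(Q(u)\cdot a+u\cdot P(a))+\lambda Q(u\cdot a)$. Let $A_P$ be $A$ with the associative product $a*_Pb=P(a)b+aP(b)+\lambda ab$, and $\overline M$ the $A_P$-bimodule with underlying space $M$, left action $(a,u)\mapsto P(a)\cdot u-Q(a\cdot u)$ and right action $(u,a)\mapsto u\cdot P(a)-Q(u\cdot a)$; let $\overline\delta_{\mathrm{Hoch}}$ be the Hochschild differential of $A_P$ with coefficients in $\overline M$. Let $\Phi^0=\mathrm{id}_M$ and, for $n\ge1$, $\Phi^n(f)(a_1,\dots,a_n)=f(P(a_1),\dots,P(a_n))-\sum_{k=0}^{n-1}\lambda^{n-k-1}\sum_{1\le i_1<\dots<i_k\le n}Q\big(f(a_1,\dots,P(a_{i_1}),\dots,P(a_{i_k}),\dots,a_n)\big)$, where $P$ is applied exactly at positions $i_1,\dots,i_k$. The complex $C^\bullet_{\mathrm{RBA}}((A,P),(M,Q))$ has $C^0_{\mathrm{RBA}}=M$, $C^n_{\mathrm{RBA}}=\mathrm{Hom}(A^{\otimes n},M)\oplus\mathrm{Hom}(A^{\otimes n-1},M)$ for $n\ge1$, with $\delta_{\mathrm{RBA}}(u)=(\delta_{\mathrm{Hoch}}(u),-u)$ and $\delta_{\mathrm{RBA}}(f,g)=(\delta_{\mathrm{Hoch}}(f),-\overline\delta_{\mathrm{Hoch}}(g)-\Phi^n(f))$, where $\delta_{\mathrm{Hoch}}$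 is that of $A$ with coefficients in $M$. Its cohomology is $H^\bullet_{\mathrm{RBA}}((A,P),(M,Q))$. Modified side. $(A,R)$ is a modified Rota-Baxter algebra of weight $\kappa$ if $R:A\to A$ is linear and $R(a)R(b)=R(R(a)b+aR(b))+\kappa ab$. A bimodule $(M,S)$ over it is an $A$-bimodule $M$ with a linear map $S:M\to M$ such that $R(a)\cdot S(u)=S(R(a)\cdot u+a\cdot S(u))+\kappa\,a\cdot u$ and $S(u)\cdot R(a)=S(S(u)\cdot a+u\cdot R(a))+\kappa\,u\cdot a$. Let $A_R$ be $A$ with the associative product $a*_Rb=R(a)b+aR(b)$, and $\widetilde M$ the $A_R$-bimodule with underlying space $M$, left action $(a,u)\mapsto R(a)\cdot u-S(a\cdot u)$ and right action $(u,a)\mapsto u\cdot R(a)-S(u\cdot a)$; let $\widetilde\delta_{\mathrm{Hoch}}$ be the Hochschild differential of $A_R$ with coefficients in $\widetilde M$. Let $\Psi^0=\mathrm{id}_M$ and, for $n\ge1$, $\Psi^n(f)(a_1,\dots,a_n)=\sum_{I\subseteq\{1,\dots,n\},\,|I|\text{ even}}(-\kappa)^{|I|/2}f(a^I_1,\dots,a^I_n)-\sum_{I\subseteq\{1,\dots,n\},\,|I|\text{ odd}}(-\kappa)^{(|I|-1)/2}S\big(f(a^I_1,\dots,a^I_n)\big)$, where $a^I_j=a_j$ if $j\in I$ and $a^I_j=R(a_j)$ if $j\notin I$. The complex $C^\bullet_{\mathrm{mRBA}}((A,R),(M,S))$ has $C^0_{\mathrm{mRBA}}=M$, $C^n_{\mathrm{mRBA}}=\mathrm{Hom}(A^{\otimes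 n},M)\oplus\mathrm{Hom}(A^{\otimes n-1},M)$ for $n\ge1$, with $\delta_{\mathrm{mRBA}}(u)=(\delta_{\mathrm{Hoch}}(u),-u)$ and $\delta_{\mathrm{mRBA}}(\chi,\Phi)=(\delta_{\mathrm{Hoch}}(\chi),-\widetilde\delta_{\mathrm{Hoch}}(\Phi)-\Psi^n(\chi))$. Its cohomology is $H^\bullet_{\mathrm{mRBA}}((A,R),(M,S))$. *)

theory Defs
  imports Complex_Main "HOL-Library.Function_Algebras" "HOL-Library.Product_Plus"
    "HOL-Library.Set_Algebras"
begin

section \<open>Algebras, bimodules and (modified) Rota--Baxter structures\<close>

text \<open>Algebras are associative and not necessarily unital; accordingly no unit law is imposed on
  bimodules.  The product is an explicit parameter because one vector space carries several.\<close>

locale assoc_algebra = vector_space scA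
  for scA :: "'k::field_char_0 \<Rightarrow> 'a::ab_group_add \<Rightarrow> 'a" +
  fixes mul :: "'a \<Rightarrow> 'a \<Rightarrow> 'a"
  assumes mul_linear_left: "Vector_Spaces.linear scA scA (\<lambda>a. mul a b)"
    and mul_linear_right: "Vector_Spaces.linear scA scA (\<lambda>b. mul a b)"
    and mul_assoc: "mul (mul a b) c = mul a (mul b c)"

locale algebra_bimodule = assoc_algebra scA mul + M: vector_space scM
  for scA :: "'k::field_char_0 \<Rightarrow> 'a::ab_group_add \<Rightarrow> 'a"
    and mul :: "'a \<Rightarrow> 'a \<Rightarrow> 'a"
    and scM :: "'k \<Rightarrow> 'm::ab_group_add \<Rightarrow> 'm" +
  fixes lact :: "'a \<Rightarrow> 'm \<Rightarrow> 'm"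
    and ract :: "'m \<Rightarrow> 'a \<Rightarrow> 'm"
  assumes lact_linear_left: "Vector_Spaces.linear scA scM (\<lambda>a. lact a u)"
    and lact_linear_right: "Vector_Spaces.linear scM scM (\<lambda>u. lact a u)"
    and ract_linear_left: "Vector_Spaces.linear scM scM (\<lambda>u. ract u a)"
    and ract_linear_right: "Vector_Spaces.linear scA scM (\<lambda>a. ract u a)"
    and lact_mul: "lact (mul a b) u = lact a (lact b u)"
    and ract_mul: "ract u (mul a b) = ract (ract u a) b"
    and lact_ract: "ract (lact a u) b = lact a (ract u b)"

locale rota_baxter_algebra = assoc_algebra scA mul
  for scA :: "'k::field_char_0 \<Rightarrow> 'a::ab_group_add \<Rightarrow> 'a"
    and mul :: "'a \<Rightarrow> 'a \<Rightarrow> 'a" +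
  fixes lam :: 'k and P :: "'a \<Rightarrow> 'a"
  assumes P_linear: "Vector_Spaces.linear scA scA P"
    and rota_baxter:
      "mul (P a) (P b) = P (mul (P a) b + mul a (P b)) + scA lam (P (mul a b))"

locale rota_baxter_bimodule =
  rota_baxter_algebra scA mul lam P + algebra_bimodule scA mul scM lact ract
  for scA :: "'k::field_char_0 \<Rightarrow> 'a::ab_group_add \<Rightarrow> 'a"
    and mul :: "'a \<Rightarrow> 'a \<Rightarrow> 'a" and lam :: 'k and P :: "'a \<Rightarrow> 'a"
    and scM :: "'k \<Rightarrow> 'm::ab_group_add \<Rightarrow> 'm"
    and lact :: "'a \<Rightarrow> 'm \<Rightarrow> 'm" and ract :: "'m \<Rightarrow> 'a \<Rightarrow> 'm" +
  fixes Q :: "'m \<Rightarrow> 'm"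
  assumes Q_linear: "Vector_Spaces.linear scM scM Q"
    and rota_baxter_left:
      "lact (P a) (Q u) = Q (lact (P a) u + lact a (Q u)) + scM lam (Q (lact a u))"
    and rota_baxter_right:
      "ract (Q u) (P a) = Q (ract (Q u) a + ract u (P a)) + scM lam (Q (ract u a))"

locale modified_rota_baxter_algebra = assoc_algebra scA mul
  for scA :: "'k::field_char_0 \<Rightarrow> 'a::ab_group_add \<Rightarrow> 'a"
    and mul :: "'a \<Rightarrow> 'a \<Rightarrow> 'a" +
  fixes kap :: 'k and R :: "'a \<Rightarrow> 'a"
  assumes R_linear: "Vector_Spaces.linear scA scA R"
    and modified_rota_baxter:
      "mul (R a) (R b) = R (mul (R a) b + mul a (R b)) + scA kap (mul a b)"

locale modified_rota_baxter_bimodule =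
  modified_rota_baxter_algebra scA mul kap R + algebra_bimodule scA mul scM lact ract
  for scA :: "'k::field_char_0 \<Rightarrow> 'a::ab_group_add \<Rightarrow> 'a"
    and mul :: "'a \<Rightarrow> 'a \<Rightarrow> 'a" and kap :: 'k and R :: "'a \<Rightarrow> 'a"
    and scM :: "'k \<Rightarrow> 'm::ab_group_add \<Rightarrow> 'm"
    and lact :: "'a \<Rightarrow> 'm \<Rightarrow> 'm" and ract :: "'m \<Rightarrow> 'a \<Rightarrow> 'm" +
  fixes S :: "'m \<Rightarrow> 'm"
  assumes S_linear: "Vector_Spaces.linear scM scM S"
    and modified_rota_baxter_left:
      "lact (R a) (S u) = S (lact (R a) u + lact a (S u)) + scM kap (lact a u)"
    and modified_rota_baxter_right:
      "ract (S u) (R a) = S (ract (S u) a + ract u (R a)) + scM kap (ract u a)"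


section \<open>Hochschild cochains\<close>

text \<open>An element of \<open>Hom(A\<^sup>\<otimes>\<^sup>n, M)\<close> is an \<open>n\<close>-linear map, represented as a function on argument
  lists that vanishes on lists of length other than \<open>n\<close>, so that equality of functions is equality
  of cochains.  For \<open>n = 0\<close> such an \<open>f\<close> is the same thing as the element \<open>f []\<close> of \<open>M\<close>.\<close>

definition cochains ::
  "('k::field \<Rightarrow> 'a::ab_group_add \<Rightarrow> 'a) \<Rightarrow> ('k \<Rightarrow> 'm::ab_group_add \<Rightarrow> 'm) \<Rightarrow> nat
     \<Rightarrow> ('a list \<Rightarrow> 'm) set" where
  "cochains scA scM n =
     {f. (\<forall>xs. length xs \<noteq> n \<longrightarrow> f xs = 0) \<and>
         (\<forall>xs ys. length xs + length ys + 1 = n \<longrightarrow>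
            Vector_Spaces.linear scA scM (\<lambda>x. f (xs @ x # ys)))}"

text \<open>The summand for \<open>i\<close> multiplies the entries in the (1-based) positions \<open>i\<close> and \<open>i + 1\<close>.\<close>

definition hochschild_diff ::
  "('a \<Rightarrow> 'a \<Rightarrow> 'a) \<Rightarrow> ('k::field \<Rightarrow> 'm::ab_group_add \<Rightarrow> 'm) \<Rightarrow> ('a \<Rightarrow> 'm \<Rightarrow> 'm) \<Rightarrow> ('m \<Rightarrow> 'a \<Rightarrow> 'm)
     \<Rightarrow> nat \<Rightarrow> ('a list \<Rightarrow> 'm) \<Rightarrow> ('a list \<Rightarrow> 'm)" where
  "hochschild_diff mul scM lact ract n f bs =
     (if length bs = n + 1 then
        scM ((-1) ^ (n + 1)) (lact (hd bs) (f (tl bs)))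
        + ract (f (butlast bs)) (last bs)
        + (\<Sum>i = 1..n. scM ((-1) ^ (i + n + 1))
             (f (take (i - 1) bs @ mul (bs ! (i - 1)) (bs ! i) # drop (i + 1) bs)))
      else 0)"

text \<open>Apply \<open>T\<close> to the entries of a list at the (0-based) positions in \<open>I\<close>.\<close>

definition apply_at :: "('a \<Rightarrow> 'a) \<Rightarrow> nat set \<Rightarrow> 'a list \<Rightarrow> 'a list" where
  "apply_at T I xs = map (\<lambda>j. if j \<in> I then T (xs ! j) else xs ! j) [0..<length xs]"


section \<open>The two cochain complexes\<close>

text \<open>Both complexes have the same underlying spaces.  An element \<open>u\<close> of the degree-0 space \<open>M\<close> is
  represented by the pair \<open>(u, 0)\<close>.\<close>

definition pair_cochains ::
  "('k::field \<Rightarrow> 'a::ab_group_add \<Rightarrow> 'a) \<Rightarrow> ('k \<Rightarrow> 'm::ab_group_add \<Rightarrow> 'm) \<Rightarrow> nat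
     \<Rightarrow> (('a list \<Rightarrow> 'm) \<times> ('a list \<Rightarrow> 'm)) set" where
  "pair_cochains scA scM n =
     (if n = 0 then cochains scA scM 0 \<times> {0}
      else cochains scA scM n \<times> cochains scA scM (n - 1))"

definition pair_scale ::
  "('k \<Rightarrow> 'm \<Rightarrow> 'm) \<Rightarrow> 'k \<Rightarrow> ('a list \<Rightarrow> 'm) \<times> ('a list \<Rightarrow> 'm)
     \<Rightarrow> ('a list \<Rightarrow> 'm) \<times> ('a list \<Rightarrow> 'm)" where
  "pair_scale scM c = (\<lambda>(f, g). (\<lambda>xs. scM c (f xs), \<lambda>xs. scM c (g xs)))"

subsection \<open>Rota--Baxter algebras\<close>

definition rb_mul ::
  "('k \<Rightarrow> 'a::ab_group_add \<Rightarrow> 'a) \<Rightarrow> ('a \<Rightarrow> 'a \<Rightarrow> 'a) \<Rightarrow> 'k \<Rightarrow> ('a \<Rightarrow> 'a) \<Rightarrow> 'a \<Rightarrow> 'a \<Rightarrow> 'a" where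
  "rb_mul scA mul lam P a b = mul (P a) b + mul a (P b) + scA lam (mul a b)"

text \<open>The following actions serve both sides: they are those of the bimodule over \<open>A\<^sub>P\<close> when
  \<open>T, U\<close> are \<open>P, Q\<close>, and those of the bimodule over \<open>A\<^sub>R\<close> when they are \<open>R, S\<close>.\<close>

definition twisted_lact ::
  "('a \<Rightarrow> 'm::ab_group_add \<Rightarrow> 'm) \<Rightarrow> ('a \<Rightarrow> 'a) \<Rightarrow> ('m \<Rightarrow> 'm) \<Rightarrow> 'a \<Rightarrow> 'm \<Rightarrow> 'm" where
  "twisted_lact lact T U a u = lact (T a) u - U (lact a u)"

definition twisted_ract ::
  "('m::ab_group_add \<Rightarrow> 'a \<Rightarrow> 'm) \<Rightarrow> ('a \<Rightarrow> 'a) \<Rightarrow> ('m \<Rightarrow> 'm) \<Rightarrow> 'm \<Rightarrow> 'a \<Rightarrow> 'm" where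
  "twisted_ract ract T U u a = ract u (T a) - U (ract u a)"

definition rb_Phi ::
  "('k::field \<Rightarrow> 'm::ab_group_add \<Rightarrow> 'm) \<Rightarrow> 'k \<Rightarrow> ('a \<Rightarrow> 'a) \<Rightarrow> ('m \<Rightarrow> 'm)
     \<Rightarrow> nat \<Rightarrow> ('a list \<Rightarrow> 'm) \<Rightarrow> ('a list \<Rightarrow> 'm)" where
  "rb_Phi scM lam P Q n f =
     (if n = 0 then f
      else (\<lambda>xs. if length xs = n then
              f (map P xs)
              - (\<Sum>k = 0..n - 1. scM (lam ^ (n - k - 1))
                   (\<Sum>I | I \<subseteq> {0..<n} \<and> card I = k. Q (f (apply_at P I xs))))
            else 0))"

definition rba_diff ::
  "('k::field \<Rightarrow> 'a::ab_group_add \<Rightarrow> 'a) \<Rightarrow> ('a \<Rightarrow> 'a \<Rightarrow> 'a) \<Rightarrow> 'k \<Rightarrow> ('a \<Rightarrow> 'a)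
     \<Rightarrow> ('k \<Rightarrow> 'm::ab_group_add \<Rightarrow> 'm) \<Rightarrow> ('a \<Rightarrow> 'm \<Rightarrow> 'm) \<Rightarrow> ('m \<Rightarrow> 'a \<Rightarrow> 'm) \<Rightarrow> ('m \<Rightarrow> 'm)
     \<Rightarrow> nat \<Rightarrow> ('a list \<Rightarrow> 'm) \<times> ('a list \<Rightarrow> 'm) \<Rightarrow> ('a list \<Rightarrow> 'm) \<times> ('a list \<Rightarrow> 'm)" where
  "rba_diff scA mul lam P scM lact ract Q n = (\<lambda>(f, g).
     if n = 0 then (hochschild_diff mul scM lact ract 0 f, - f)
     else (hochschild_diff mul scM lact ract n f,
           - hochschild_diff (rb_mul scA mul lam P) scM
               (twisted_lact lact P Q) (twisted_ract ract P Q) (n - 1) g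
           - rb_Phi scM lam P Q n f))"

subsection \<open>Modified Rota--Baxter algebras\<close>

definition mrb_mul ::
  "('a::ab_group_add \<Rightarrow> 'a \<Rightarrow> 'a) \<Rightarrow> ('a \<Rightarrow> 'a) \<Rightarrow> 'a \<Rightarrow> 'a \<Rightarrow> 'a" where
  "mrb_mul mul R a b = mul (R a) b + mul a (R b)"

definition mrb_Psi ::
  "('k::field \<Rightarrow> 'm::ab_group_add \<Rightarrow> 'm) \<Rightarrow> 'k \<Rightarrow> ('a \<Rightarrow> 'a) \<Rightarrow> ('m \<Rightarrow> 'm)
     \<Rightarrow> nat \<Rightarrow> ('a list \<Rightarrow> 'm) \<Rightarrow> ('a list \<Rightarrow> 'm)" where
  "mrb_Psi scM kap R S n f =
     (if n = 0 then f
      else (\<lambda>xs. if length xs = n then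
              (\<Sum>I | I \<subseteq> {0..<n} \<and> even (card I).
                 scM ((- kap) ^ (card I div 2)) (f (apply_at R ({0..<n} - I) xs)))
              - (\<Sum>I | I \<subseteq> {0..<n} \<and> odd (card I).
                   scM ((- kap) ^ ((card I - 1) div 2)) (S (f (apply_at R ({0..<n} - I) xs))))
            else 0))"

definition mrba_diff ::
  "('a::ab_group_add \<Rightarrow> 'a \<Rightarrow> 'a) \<Rightarrow> 'k::field \<Rightarrow> ('a \<Rightarrow> 'a)
     \<Rightarrow> ('k \<Rightarrow> 'm::ab_group_add \<Rightarrow> 'm) \<Rightarrow> ('a \<Rightarrow> 'm \<Rightarrow> 'm) \<Rightarrow> ('m \<Rightarrow> 'a \<Rightarrow> 'm) \<Rightarrow> ('m \<Rightarrow> 'm)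
     \<Rightarrow> nat \<Rightarrow> ('a list \<Rightarrow> 'm) \<times> ('a list \<Rightarrow> 'm) \<Rightarrow> ('a list \<Rightarrow> 'm) \<times> ('a list \<Rightarrow> 'm)" where
  "mrba_diff mul kap R scM lact ract S n = (\<lambda>(f, g).
     if n = 0 then (hochschild_diff mul scM lact ract 0 f, - f)
     else (hochschild_diff mul scM lact ract n f,
           - hochschild_diff (mrb_mul mul R) scM
               (twisted_lact lact R S) (twisted_ract ract R S) (n - 1) g
           - mrb_Psi scM kap R S n f))"


section \<open>Cohomology\<close>

record ('k, 'v) lin_space =
  vectors :: "'v set"
  vadd :: "'v \<Rightarrow> 'v \<Rightarrow> 'v"
  vscale :: "'k \<Rightarrow> 'v \<Rightarrow> 'v"

definition lin_iso ::
  "('k, 'v) lin_space \<Rightarrow> ('k, 'w) lin_space \<Rightarrow> ('v \<Rightarrow> 'w) \<Rightarrow> bool" where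
  "lin_iso V W h \<longleftrightarrow>
     bij_betw h (vectors V) (vectors W) \<and>
     (\<forall>x\<in>vectors V. \<forall>y\<in>vectors V. h (vadd V x y) = vadd W (h x) (h y)) \<and>
     (\<forall>c. \<forall>x\<in>vectors V. h (vscale V c x) = vscale W c (h x))"

definition lin_isomorphic :: "('k, 'v) lin_space \<Rightarrow> ('k, 'w) lin_space \<Rightarrow> bool" where
  "lin_isomorphic V W \<longleftrightarrow> (\<exists>h. lin_iso V W h)"

text \<open>The quotient of a subspace \<open>Z\<close> by a subspace \<open>B\<close> consists of the cosets \<open>z + B\<close>.  In the
  scalar multiplication, adding \<open>B\<close> matters only for \<open>c = 0\<close>, where \<open>s 0 ` X\<close> is just \<open>{0}\<close>.\<close>

definition quotient_space ::
  "('k \<Rightarrow> 'v::ab_group_add \<Rightarrow> 'v) \<Rightarrow> 'v set \<Rightarrow> 'v set \<Rightarrow> ('k, 'v set) lin_space" where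
  "quotient_space s Z B =
     \<lparr>vectors = (\<lambda>z. z +o B) ` Z,
      vadd = (\<lambda>X Y. X + Y),
      vscale = (\<lambda>c X. s c ` X + B)\<rparr>"

definition cohomology ::
  "('k \<Rightarrow> 'v::ab_group_add \<Rightarrow> 'v) \<Rightarrow> (nat \<Rightarrow> 'v set) \<Rightarrow> (nat \<Rightarrow> 'v \<Rightarrow> 'v) \<Rightarrow> nat
     \<Rightarrow> ('k, 'v set) lin_space" where
  "cohomology s C d n =
     quotient_space s {z \<in> C n. d n z = 0} (if n = 0 then {0} else d (n - 1) ` C (n - 1))"

definition rba_cohomology ::
  "('k::field \<Rightarrow> 'a::ab_group_add \<Rightarrow> 'a) \<Rightarrow> ('a \<Rightarrow> 'a \<Rightarrow> 'a) \<Rightarrow> 'k \<Rightarrow> ('a \<Rightarrow> 'a)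
     \<Rightarrow> ('k \<Rightarrow> 'm::ab_group_add \<Rightarrow> 'm) \<Rightarrow> ('a \<Rightarrow> 'm \<Rightarrow> 'm) \<Rightarrow> ('m \<Rightarrow> 'a \<Rightarrow> 'm) \<Rightarrow> ('m \<Rightarrow> 'm)
     \<Rightarrow> nat \<Rightarrow> ('k, (('a list \<Rightarrow> 'm) \<times> ('a list \<Rightarrow> 'm)) set) lin_space" where
  "rba_cohomology scA mul lam P scM lact ract Q =
     cohomology (pair_scale scM) (pair_cochains scA scM)
       (rba_diff scA mul lam P scM lact ract Q)"

definition mrba_cohomology ::
  "('k::field \<Rightarrow> 'a::ab_group_add \<Rightarrow> 'a) \<Rightarrow> ('a \<Rightarrow> 'a \<Rightarrow> 'a) \<Rightarrow> 'k \<Rightarrow> ('a \<Rightarrow> 'a)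
     \<Rightarrow> ('k \<Rightarrow> 'm::ab_group_add \<Rightarrow> 'm) \<Rightarrow> ('a \<Rightarrow> 'm \<Rightarrow> 'm) \<Rightarrow> ('m \<Rightarrow> 'a \<Rightarrow> 'm) \<Rightarrow> ('m \<Rightarrow> 'm)
     \<Rightarrow> nat \<Rightarrow> ('k, (('a list \<Rightarrow> 'm) \<times> ('a list \<Rightarrow> 'm)) set) lin_space" where
  "mrba_cohomology scA mul kap R scM lact ract S =
     cohomology (pair_scale scM) (pair_cochains scA scM)
       (mrba_diff mul kap R scM lact ract S)"

end

theory Submission
  imports Defs
begin

text \<open>The product of \<open>A\<^sub>R\<close> and its actions on the twisted bimodule are twice those of \<open>A\<^sub>P\<close>, so the
  twisted Hochschild differential doubles as well.  Expanding \<open>R = \<lambda> id + 2P\<close> in every slot and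
  counting the subsets of even and of odd size gives \<open>\<Psi>\<^sup>n = 2\<^sup>n \<Phi>\<^sup>n\<close>.  Hence
  \<open>(f, g) \<mapsto> (f, 2\<^sup>n\<^sup>-\<^sup>1 g)\<close> in degree \<open>n \<ge> 1\<close> and the identity in degree \<open>0\<close> form an isomorphism
  of complexes.\<close>

section \<open>Subset counts by parity and multilinear expansion\<close>

lemma card_parity_subsets:
  assumes "finite K" "K \<noteq> {}"
  shows "card {I. I \<subseteq> K \<and> even (card I)} = 2 ^ (card K - 1)"
    and "card {I. I \<subseteq> K \<and> odd (card I)} = 2 ^ (card K - 1)"
proof -
  have eq: "card {I. I \<subseteq> K \<and> even (card I)} = card {I. I \<subseteq> K \<and> odd (card I)}"
    using card_subsupersets_even_odd[of K "{}"] assms by auto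
  have "Pow K = {I. I \<subseteq> K \<and> even (card I)} \<union> {I. I \<subseteq> K \<and> odd (card I)}"
    by auto
  then have "card (Pow K) = card {I. I \<subseteq> K \<and> even (card I)} + card {I. I \<subseteq> K \<and> odd (card I)}"
    using assms by (simp only:) (subst card_Un_disjoint; auto)
  moreover have "card (Pow K) = 2 * 2 ^ (card K - 1)"
    using assms by (cases "card K") (auto simp: card_Pow)
  ultimately show "card {I. I \<subseteq> K \<and> even (card I)} = 2 ^ (card K - 1)"
    and "card {I. I \<subseteq> K \<and> odd (card I)} = 2 ^ (card K - 1)"
    using eq by simp_all
qed

text \<open>\<open>K\<close> holds the slots still to be expanded, \<open>L\<close> those where the
  \<open>d\<close>-summand has been chosen. Induction peels one slot off \<open>K\<close>; the
  second branch moves it into \<open>L\<close>, so the claim is proved for all \<open>L\<close>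
  disjoint from \<open>K\<close>.\<close>

lemma (in vector_space) expand_slots:
  assumes "finite K" "K \<subseteq> U" "K \<inter> L = {}"
    and step: "\<And>k K L. \<lbrakk>k \<in> U; k \<notin> K; k \<notin> L\<rbrakk> \<Longrightarrow>
      G (insert k K) L = scale c (G K L) + scale d (G K (insert k L))"
  shows "G K L = (\<Sum>J\<in>Pow K. scale (c ^ (card K - card J) * d ^ card J) (G {} (L \<union> J)))"
  using assms(1-3)
proof (induction K arbitrary: L rule: finite_induct)
  case empty
  then show ?case by simp
next
  case (insert k K)
  let ?t = "\<lambda>J. scale (c ^ (card (insert k K) - card J) * d ^ card J) (G {} (L \<union> J))"
  have fin: "finite J" "card J \<le> card K" "k \<notin> J" if "J \<in> Pow K" for J
    using that insert.hyps by (auto intro: finite_subset card_mono)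
  have inj: "inj_on (insert k) (Pow K)"
    using insert.hyps(2) by (auto simp: inj_on_def)
  \<comment> \<open>Subsets of \<open>insert k K\<close> avoiding \<open>k\<close> gain a factor
    \<open>c\<close>; those containing \<open>k\<close> are the \<open>insert k J\<close> and gain a
    factor \<open>d\<close>.\<close>
  have 1: "scale c (G K L) = sum ?t (Pow K)"
    using insert by (auto simp: scale_sum_right Suc_diff_le fin mult.assoc intro!: sum.cong)
  have "scale d (G K (insert k L)) = (\<Sum>J\<in>Pow K. ?t (insert k J))"
    using insert by (auto simp: scale_sum_right fin mult_ac intro!: sum.cong)
  also have "\<dots> = sum ?t (insert k ` Pow K)"
    using inj by (simp add: sum.reindex)
  finally have 2: "scale d (G K (insert k L)) = sum ?t (insert k ` Pow K)" .
  have "G (insert k K) L = sum ?t (Pow K) + sum ?t (insert k ` Pow K)"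
    using insert.prems insert.hyps by (subst step) (auto simp: 1 2)
  also have "\<dots> = sum ?t (Pow (insert k K))"
    unfolding Pow_insert using insert.hyps by (subst sum.union_disjoint) auto
  finally show ?case .
qed

lemma cochains_update:
  assumes "f \<in> cochains scA scM n" "length ys = n" "k < n"
  shows "f (ys[k := scA c x + scA d y]) = scM c (f (ys[k := x])) + scM d (f (ys[k := y]))"
proof -
  have "Vector_Spaces.linear scA scM (\<lambda>x. f (take k ys @ x # drop (Suc k) ys))"
    using assms by (auto simp: cochains_def)
  then show ?thesis
    using assms by (simp add: Vector_Spaces.linear_iff upd_conv_take_nth_drop)
qed

lemma cochains_scale:
  assumes "f \<in> cochains scA scM n" "length (xs @ ys) + 1 = n"
  shows "f (xs @ scA c x # ys) = scM c (f (xs @ x # ys))"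
  using assms by (auto simp: cochains_def Vector_Spaces.linear_iff)

lemma (in algebra_bimodule) cochains_expand:
  assumes "f \<in> cochains scA scM n" "length xs = n" "K \<subseteq> {0..<n}"
    and T: "T = (\<lambda>a. scA c a + scA d (U a))"
  shows "f (apply_at T K xs) =
    (\<Sum>J\<in>Pow K. scM (c ^ (card K - card J) * d ^ card J) (f (apply_at U J xs)))"
proof -
  \<comment> \<open>Slots in \<open>K\<close> carry the unexpanded \<open>T\<close>, slots in
    \<open>L\<close> carry \<open>U\<close>, all others their plain entry.\<close>
  define G where "G K L = f (map (\<lambda>j. if j \<in> K then T (xs ! j) else if j \<in> L then U (xs ! j)
    else xs ! j) [0..<length xs])" for K L
  have "G K {} = (\<Sum>J\<in>Pow K. scM (c ^ (card K - card J) * d ^ card J) (G {} ({} \<union> J)))"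
  proof (rule M.expand_slots)
    fix k K L assume k: "k \<in> {0..<n}" "k \<notin> K" "k \<notin> L"
    \<comment> \<open>As \<open>k\<close> lies in neither set, slot \<open>k\<close> of
      \<open>ys\<close> is plain, and the three values of \<open>G\<close> in question differ in
      that slot only.\<close>
    define ys where "ys = map (\<lambda>j. if j \<in> K then T (xs ! j) else if j \<in> L then U (xs ! j)
      else xs ! j) [0..<length xs]"
    have "G (insert k K) L = f (ys[k := T (xs ! k)])" "G K L = f (ys[k := xs ! k])"
      "G K (insert k L) = f (ys[k := U (xs ! k)])"
      unfolding G_def ys_def using k assms(2)
      by (auto intro!: arg_cong[where f = f] nth_equalityI simp: nth_list_update)
    then show "G (insert k K) L = scM c (G K L) + scM d (G K (insert k L))"
      using cochains_update[OF assms(1), of ys k] k assms(2) by (simp add: T ys_def)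
  qed (use assms(3) finite_subset in auto)
  then show ?thesis
    by (simp add: G_def apply_at_def cong: if_cong)
qed

section \<open>From Rota-Baxter to modified Rota-Baxter structures\<close>

context rota_baxter_bimodule
begin

lemmas bilinear_simps =
  mul_linear_left[unfolded Vector_Spaces.linear_iff, THEN conjunct2, THEN conjunct2]
  mul_linear_right[unfolded Vector_Spaces.linear_iff, THEN conjunct2, THEN conjunct2]
  lact_linear_left[unfolded Vector_Spaces.linear_iff, THEN conjunct2, THEN conjunct2]
  lact_linear_right[unfolded Vector_Spaces.linear_iff, THEN conjunct2, THEN conjunct2]
  ract_linear_left[unfolded Vector_Spaces.linear_iff, THEN conjunct2, THEN conjunct2]
  ract_linear_right[unfolded Vector_Spaces.linear_iff, THEN conjunct2, THEN conjunct2]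
  P_linear[unfolded Vector_Spaces.linear_iff, THEN conjunct2, THEN conjunct2]
  Q_linear[unfolded Vector_Spaces.linear_iff, THEN conjunct2, THEN conjunct2]

text \<open>In the difference of R(a)R(b) and R(R(a)b + aR(b)) the terms 2 lam (P(a)b + aP(b))
  cancel. What remains is - lam^2 ab plus four times the defect of the Rota-Baxter identity, which
  is zero.\<close>

lemma modified_algebra:
  assumes R: "R = (\<lambda>a. scA lam a + scA 2 (P a))"
  shows "modified_rota_baxter_algebra scA mul (- (lam ^ 2)) R"
proof
  show "R (x + y) = R x + R y" "R (scA c x) = scA c (R x)" for x y c
    by (simp_all add: R bilinear_simps scale_right_distrib mult.commute)
  show "mul (R a) (R b) = R (mul (R a) b + mul a (R b)) + scA (- (lam ^ 2)) (mul a b)" for a b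
  proof -
    \<comment> \<open>Doubled scalars are split into sums so that the cancellation becomes
      arithmetic in an abelian group.\<close>
    have two: "scA (x * 2) v = scA x v + scA x v" for x v
      by (simp add: scale_left_distrib[symmetric])
    show ?thesis
      by (simp add: R bilinear_simps rota_baxter scale_right_distrib algebra_simps
          power2_eq_square two scale_left_distrib[of 1 1, simplified])
  qed
qed

text \<open>The cancellation is that of \<open>modified_algebra\<close> with one factor in the
  bimodule, once on each side.\<close>

lemma modified_bimodule:
  assumes R: "R = (\<lambda>a. scA lam a + scA 2 (P a))" and S: "S = (\<lambda>u. scM lam u + scM 2 (Q u))"
  shows "modified_rota_baxter_bimodule scA mul (- (lam ^ 2)) R scM lact ract S"
proof -
  interpret modified_rota_baxter_algebra scA mul "- (lam ^ 2)" R
    by (rule modified_algebra[OF R])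
  have two: "scM (x * 2) v = scM x v + scM x v" for x v
    by (simp add: M.scale_left_distrib[symmetric])
  show ?thesis
  proof
    show "S (x + y) = S x + S y" "S (scM c x) = scM c (S x)" for x y c
      by (simp_all add: S bilinear_simps M.scale_right_distrib mult.commute)
    show "lact (R a) (S u) = S (lact (R a) u + lact a (S u)) + scM (- (lam ^ 2)) (lact a u)" for a u
      by (simp add: R S bilinear_simps rota_baxter_left M.scale_right_distrib algebra_simps
          power2_eq_square two M.scale_left_distrib[of 1 1, simplified])
    show "ract (S u) (R a) = S (ract (S u) a + ract u (R a)) + scM (- (lam ^ 2)) (ract u a)" for a u
      by (simp add: R S bilinear_simps rota_baxter_right M.scale_right_distrib algebra_simps
          power2_eq_square two M.scale_left_distrib[of 1 1, simplified])
  qed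
qed

section \<open>Comparison of Psi and Phi\<close>

text \<open>\<open>I\<close> marks the slots left plain, \<open>J\<close> those where expanding
  \<open>R\<close> picks 2P. After the sums are swapped the power of \<open>lam\<close> depends on
  \<open>J\<close> only, so the sum over \<open>I\<close> becomes a count. Even sizes use
  \<open>m = 0\<close>, odd sizes \<open>m = 1\<close>.\<close>

lemma sum_over_subsets_expand:
  assumes f: "f \<in> cochains scA scM n" "length xs = n"
    and R: "R = (\<lambda>a. scA lam a + scA 2 (P a))"
    and m: "\<And>i. p i \<Longrightarrow> m \<le> i"
  shows "(\<Sum>I | I \<subseteq> {0..<n} \<and> p (card I).
      scM (lam ^ (card I - m)) (f (apply_at R ({0..<n} - I) xs))) =
    (\<Sum>J\<in>Pow {0..<n}. scM (of_nat (card {I. I \<subseteq> {0..<n} - J \<and> p (card I)}) *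
      (lam ^ (n - card J - m) * 2 ^ card J)) (f (apply_at P J xs)))"
    (is "sum ?l ?A = _")
proof -
  let ?N = "{0..<n}"
  let ?t = "\<lambda>J. scM (lam ^ (n - card J - m) * 2 ^ card J) (f (apply_at P J xs))"
  have "sum ?l ?A = (\<Sum>I\<in>?A. \<Sum>J | J \<in> Pow ?N \<and> J \<subseteq> ?N - I. ?t J)"
  proof (rule sum.cong[OF refl])
    fix I assume I: "I \<in> ?A"
    have cI: "card (?N - I) = n - card I" "card I \<le> n" "m \<le> card I"
      using I m card_mono[of ?N I] by (auto simp: card_Diff_subset finite_subset)
    have "?l I = (\<Sum>J\<in>Pow (?N - I). scM (lam ^ (card I - m) *
        (lam ^ (card (?N - I) - card J) * 2 ^ card J)) (f (apply_at P J xs)))"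
      by (subst cochains_expand[OF f _ R]) (auto simp: M.scale_sum_right)
    also have "\<dots> = (\<Sum>J\<in>Pow (?N - I). ?t J)"
    proof (rule sum.cong[OF refl])
      fix J assume "J \<in> Pow (?N - I)"
      then have "card J \<le> n - card I"
        using card_mono[of "?N - I" J] cI by auto
      \<comment> \<open>\<open>card I\<close> cancels; \<open>m \<le> card I\<close> and
        \<open>card J \<le> n - card I\<close> keep the truncated subtractions exact.\<close>
      then have "n - card J - m = card I - m + (n - card I - card J)"
        using cI by auto
      then show "scM (lam ^ (card I - m) * (lam ^ (card (?N - I) - card J) * 2 ^ card J))
          (f (apply_at P J xs)) = ?t J"
        by (simp only: cI power_add mult.assoc)
    qed
    also have "Pow (?N - I) = {J. J \<in> Pow ?N \<and> J \<subseteq> ?N - I}"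
      by auto
    finally show "?l I = (\<Sum>J | J \<in> Pow ?N \<and> J \<subseteq> ?N - I. ?t J)" .
  qed
  \<comment> \<open>The condition relating \<open>I\<close> and \<open>J\<close> is disjointness,
    which is symmetric.\<close>
  also have "\<dots> = (\<Sum>J\<in>Pow ?N. \<Sum>I | I \<in> ?A \<and> J \<subseteq> ?N - I. ?t J)"
    by (rule sum.swap_restrict) auto
  also have "\<dots> = (\<Sum>J\<in>Pow ?N. \<Sum>I | I \<subseteq> ?N - J \<and> p (card I). ?t J)"
    by (intro sum.cong refl) auto
  finally show ?thesis
    by (simp add: M.sum_constant_scale)
qed

text \<open>For a proper subset \<open>J\<close> each parity admits 2^(n-|J|-1) sets
  \<open>I\<close>; together with the 2^|J| from the expansion this is 2^(n-1), whatever
  \<open>J\<close> is. Hence both parts of Psi are multiples of one sum \<open>W\<close>, the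
  argument of \<open>Q\<close> in Phi, apart from the term f(P(a_1),...,P(a_n)).\<close>

lemma Psi_eq_Phi:
  assumes R: "R = (\<lambda>a. scA lam a + scA 2 (P a))" and S: "S = (\<lambda>u. scM lam u + scM 2 (Q u))"
    and f: "f \<in> cochains scA scM n"
  shows "mrb_Psi scM (- (lam ^ 2)) R S n f xs = scM (2 ^ n) (rb_Phi scM lam P Q n f xs)"
proof (cases "n > 0 \<and> length xs = n")
  case False
  then show ?thesis by (auto simp: mrb_Psi_def rb_Phi_def)
next
  case True
  then have n: "n > 0" and len: "length xs = n" by auto
  let ?N = "{0..<n}"
  let ?F = "\<lambda>J. f (apply_at P J xs)"
  define W where "W = (\<Sum>J\<in>Pow ?N - {?N}. scM (lam ^ (n - card J - 1)) (?F J))"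
  have card_compl: "card (?N - J) = n - card J" "card J < n" "?N - J \<noteq> {}"
    if "J \<in> Pow ?N - {?N}" for J
    using that psubset_card_mono[of ?N J] by (auto simp: card_Diff_subset finite_subset)
  have split: "sum g (Pow ?N) = g ?N + sum g (Pow ?N - {?N})" for g :: "nat set \<Rightarrow> 'm"
    by (rule sum.remove) auto
  have half: "2 ^ (n - card J - 1) * (x * 2 ^ card J) = 2 ^ (n - 1) * x"
    if "J \<in> Pow ?N - {?N}" for J and x :: 'k
  proof -
    have "n - 1 = n - card J - 1 + card J" using card_compl[OF that] by simp
    then show ?thesis by (simp only: power_add mult_ac)
  qed
  \<comment> \<open>Since - kap is lam^2, the weight of an even \<open>I\<close> is a plain power of
    \<open>lam\<close>; the \<open>- 0\<close> fits the case \<open>m = 0\<close>.\<close>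
  have "(\<Sum>I | I \<subseteq> ?N \<and> even (card I). scM ((lam ^ 2) ^ (card I div 2)) (f (apply_at R (?N - I) xs)))
      = (\<Sum>I | I \<subseteq> ?N \<and> even (card I). scM (lam ^ (card I - 0)) (f (apply_at R (?N - I) xs)))"
    by (intro sum.cong refl) (auto simp flip: power_mult)
  also have "\<dots> = (\<Sum>J\<in>Pow ?N. scM (of_nat (card {I. I \<subseteq> ?N - J \<and> even (card I)}) *
      (lam ^ (n - card J - 0) * 2 ^ card J)) (?F J))"
    by (rule sum_over_subsets_expand[OF f len R]) auto
  also have "\<dots> = scM (2 ^ n) (?F ?N) + (\<Sum>J\<in>Pow ?N - {?N}. scM (2 ^ (n - 1) * lam)
      (scM (lam ^ (n - card J - 1)) (?F J)))"
  proof (subst split, rule arg_cong2[where f = "(+)"])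
    \<comment> \<open>For \<open>J = ?N\<close> only the empty \<open>I\<close> is left, and it is
      even: the source of the term without \<open>Q\<close>.\<close>
    have "{I. I \<subseteq> {} \<and> even (card I)} = {{} :: nat set}" by auto
    then show "scM (of_nat (card {I. I \<subseteq> ?N - ?N \<and> even (card I)}) *
      (lam ^ (n - card ?N - 0) * 2 ^ card ?N)) (?F ?N) = scM (2 ^ n) (?F ?N)"
      by simp
    show "(\<Sum>J\<in>Pow ?N - {?N}. scM (of_nat (card {I. I \<subseteq> ?N - J \<and> even (card I)}) *
      (lam ^ (n - card J - 0) * 2 ^ card J)) (?F J)) = (\<Sum>J\<in>Pow ?N - {?N}. scM (2 ^ (n - 1) * lam)
      (scM (lam ^ (n - card J - 1)) (?F J)))"
    proof (rule sum.cong[OF refl])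
      fix J assume J: "J \<in> Pow ?N - {?N}"
      \<comment> \<open>The exponent here is one higher than in \<open>W\<close>, whence the extra
        factor \<open>lam\<close>.\<close>
      have "n - card J = Suc (n - card J - 1)" using card_compl[OF J] by simp
      then have "lam ^ (n - card J) = lam * lam ^ (n - card J - 1)"
        by (metis power_Suc)
      then show "scM (of_nat (card {I. I \<subseteq> ?N - J \<and> even (card I)}) *
          (lam ^ (n - card J - 0) * 2 ^ card J)) (?F J) =
        scM (2 ^ (n - 1) * lam) (scM (lam ^ (n - card J - 1)) (?F J))"
        using half[OF J, of "lam ^ (n - card J)"] card_compl[OF J]
        by (simp add: card_parity_subsets mult.assoc)
    qed
  qed
  finally have even_part: "(\<Sum>I | I \<subseteq> ?N \<and> even (card I).
      scM ((lam ^ 2) ^ (card I div 2)) (f (apply_at R (?N - I) xs)))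
    = scM (2 ^ n) (?F ?N) + scM (2 ^ (n - 1) * lam) W"
    by (simp only: W_def M.scale_sum_right)
  have "(\<Sum>I | I \<subseteq> ?N \<and> odd (card I).
        scM ((lam ^ 2) ^ ((card I - 1) div 2)) (f (apply_at R (?N - I) xs)))
      = (\<Sum>I | I \<subseteq> ?N \<and> odd (card I). scM (lam ^ (card I - 1)) (f (apply_at R (?N - I) xs)))"
    by (intro sum.cong refl) (auto simp flip: power_mult)
  also have "\<dots> = (\<Sum>J\<in>Pow ?N. scM (of_nat (card {I. I \<subseteq> ?N - J \<and> odd (card I)}) *
      (lam ^ (n - card J - 1) * 2 ^ card J)) (?F J))"
    by (rule sum_over_subsets_expand[OF f len R]) (auto elim: oddE)
  also have "\<dots> = 0 + (\<Sum>J\<in>Pow ?N - {?N}. scM (2 ^ (n - 1)) (scM (lam ^ (n - card J - 1)) (?F J)))"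
  proof (subst split, rule arg_cong2[where f = "(+)"])
    \<comment> \<open>The empty set has no odd subset, so \<open>J = ?N\<close> contributes nothing
      to the argument of \<open>S\<close>.\<close>
    have "{I. I \<subseteq> {} \<and> odd (card I)} = ({} :: nat set set)" by auto
    then show "scM (of_nat (card {I. I \<subseteq> ?N - ?N \<and> odd (card I)}) *
      (lam ^ (n - card ?N - 1) * 2 ^ card ?N)) (?F ?N) = 0"
      by simp
    show "(\<Sum>J\<in>Pow ?N - {?N}. scM (of_nat (card {I. I \<subseteq> ?N - J \<and> odd (card I)}) *
      (lam ^ (n - card J - 1) * 2 ^ card J)) (?F J)) =
      (\<Sum>J\<in>Pow ?N - {?N}. scM (2 ^ (n - 1)) (scM (lam ^ (n - card J - 1)) (?F J)))"
    proof (rule sum.cong[OF refl])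
      fix J assume J: "J \<in> Pow ?N - {?N}"
      show "scM (of_nat (card {I. I \<subseteq> ?N - J \<and> odd (card I)}) *
          (lam ^ (n - card J - 1) * 2 ^ card J)) (?F J) =
        scM (2 ^ (n - 1)) (scM (lam ^ (n - card J - 1)) (?F J))"
        using half[OF J, of "lam ^ (n - card J - 1)"] card_compl[OF J]
        by (simp add: card_parity_subsets)
    qed
  qed
  finally have odd_part: "(\<Sum>I | I \<subseteq> ?N \<and> odd (card I).
      scM ((lam ^ 2) ^ ((card I - 1) div 2)) (f (apply_at R (?N - I) xs))) = scM (2 ^ (n - 1)) W"
    by (simp add: W_def M.scale_sum_right)
  interpret S: Vector_Spaces.linear scM scM S
    using modified_bimodule[OF R S] by (rule modified_rota_baxter_bimodule.S_linear)
  interpret Q: Vector_Spaces.linear scM scM Q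
    by (rule Q_linear)
  \<comment> \<open>The sizes up to \<open>n - 1\<close> are exactly those of proper subsets, so
    grouping by cardinality turns the double sum in Phi into \<open>Q W\<close>.\<close>
  have "(\<Sum>k = 0..n - 1. scM (lam ^ (n - k - 1)) (\<Sum>I | I \<subseteq> ?N \<and> card I = k. Q (?F I)))
      = (\<Sum>k = 0..n - 1. \<Sum>I | I \<in> Pow ?N - {?N} \<and> card I = k.
          scM (lam ^ (n - card I - 1)) (Q (?F I)))"
  proof (rule sum.cong[OF refl])
    fix k assume "k \<in> {0..n - 1}"
    then have "{I. I \<subseteq> ?N \<and> card I = k} = {I. I \<in> Pow ?N - {?N} \<and> card I = k}"
      using n by auto
    then show "scM (lam ^ (n - k - 1)) (\<Sum>I | I \<subseteq> ?N \<and> card I = k. Q (?F I)) =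
        (\<Sum>I | I \<in> Pow ?N - {?N} \<and> card I = k. scM (lam ^ (n - card I - 1)) (Q (?F I)))"
      by (auto simp: M.scale_sum_right intro!: sum.cong)
  qed
  also have "\<dots> = (\<Sum>I\<in>Pow ?N - {?N}. scM (lam ^ (n - card I - 1)) (Q (?F I)))"
  proof (rule sum.group)
    show "card ` (Pow ?N - {?N}) \<subseteq> {0..n - 1}"
    proof (rule image_subsetI)
      fix J assume "J \<in> Pow ?N - {?N}"
      from card_compl(2)[OF this] show "card J \<in> {0..n - 1}" by simp
    qed
  qed auto
  also have "\<dots> = Q W"
    by (simp add: W_def Q.sum Q.scale)
  finally have Phi_sum: "(\<Sum>k = 0..n - 1. scM (lam ^ (n - k - 1))
      (\<Sum>I | I \<subseteq> ?N \<and> card I = k. Q (?F I))) = Q W" .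
  have full: "apply_at P ?N xs = map P xs"
    by (rule nth_equalityI) (simp_all add: apply_at_def len)
  have Phi: "rb_Phi scM lam P Q n f xs = ?F ?N - Q W"
    using n len Phi_sum by (simp add: rb_Phi_def full)
  have "mrb_Psi scM (- (lam ^ 2)) R S n f xs =
      scM (2 ^ n) (?F ?N) + scM (2 ^ (n - 1) * lam) W - S (scM (2 ^ (n - 1)) W)"
    using n len even_part arg_cong[OF odd_part, of S] by (simp add: mrb_Psi_def S.sum S.scale)
  \<comment> \<open>The \<open>lam\<close> part of \<open>S\<close> cancels the multiple of
    \<open>W\<close> from the even sum; its 2Q part raises 2^(n-1) to 2^n.\<close>
  also have "\<dots> = scM (2 ^ n) (?F ?N - Q W)"
    using n by (cases n) (simp_all add: S Q.scale M.scale_right_diff_distrib mult_ac)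
  finally show ?thesis
    by (simp add: Phi)
qed

section \<open>Compatibility with the differentials\<close>

text \<open>Each summand of the differential involves exactly one twisted operation, the product or
  an action, and each of these doubles. The scalar \<open>c\<close> accommodates the rescaling of
  \<open>g\<close> by the cochain map.\<close>

lemma hochschild_diff_twisted:
  assumes R: "R = (\<lambda>a. scA lam a + scA 2 (P a))" and S: "S = (\<lambda>u. scM lam u + scM 2 (Q u))"
    and g: "g \<in> cochains scA scM m"
  shows "hochschild_diff (mrb_mul mul R) scM (twisted_lact lact R S) (twisted_ract ract R S) m
      (\<lambda>xs. scM c (g xs)) bs =
    scM (2 * c) (hochschild_diff (rb_mul scA mul lam P) scM
      (twisted_lact lact P Q) (twisted_ract ract P Q) m g bs)"
proof (cases "length bs = m + 1")
  case False
  then show ?thesis by (simp add: hochschild_diff_def)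
next
  case True
  have two: "scA (x * 2) v = scA x v + scA x v" for x v
    by (simp add: scale_left_distrib[symmetric])
  have mul: "mrb_mul mul R a b = scA 2 (rb_mul scA mul lam P a b)" for a b
    by (simp add: mrb_mul_def rb_mul_def R bilinear_simps scale_right_distrib algebra_simps two
        scale_left_distrib[of 1 1, simplified])
  \<comment> \<open>The \<open>lam\<close> parts of \<open>R\<close> and \<open>S\<close> contribute
    the same term with opposite signs and cancel.\<close>
  have l: "twisted_lact lact R S a (scM c u) = scM (2 * c) (twisted_lact lact P Q a u)" for a u
    by (simp add: twisted_lact_def R S bilinear_simps M.scale_right_diff_distrib algebra_simps)
  have r: "twisted_ract ract R S (scM c u) a = scM (2 * c) (twisted_ract ract P Q u a)" for a u
    by (simp add: twisted_ract_def R S bilinear_simps M.scale_right_diff_distrib algebra_simps)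
  have g2: "g (take (i - 1) bs @ scA 2 x # drop (i + 1) bs) =
      scM 2 (g (take (i - 1) bs @ x # drop (i + 1) bs))" if "i \<in> {1..m}" for i x
    by (rule cochains_scale[OF g]) (use that True in auto)
  show ?thesis
    using True
    by (simp add: hochschild_diff_def l r mul g2[simplified] M.scale_right_distrib
        M.scale_right_diff_distrib M.scale_sum_right mult_ac cong: sum.cong_simp)
qed

text \<open>The doubled twisted differential turns the factor 2^(n-1) on \<open>g\<close> into 2^n,
  which is also the factor between Phi and Psi.\<close>

lemma differentials_intertwined:
  assumes R: "R = (\<lambda>a. scA lam a + scA 2 (P a))" and S: "S = (\<lambda>u. scM lam u + scM 2 (Q u))"
    and z: "z \<in> pair_cochains scA scM n"
  shows "map_prod id (\<lambda>g xs. scM (2 ^ n) (g xs)) (rba_diff scA mul lam P scM lact ract Q n z) =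
    mrba_diff mul (- (lam ^ 2)) R scM lact ract S n
      (map_prod id (\<lambda>g xs. scM (2 ^ (n - 1)) (g xs)) z)"
proof (cases n)
  \<comment> \<open>Here the truncated \<open>n - 1\<close> is 0, so both scalings are by 1.\<close>
  case 0
  then show ?thesis
    by (cases z) (simp add: rba_diff_def mrba_diff_def fun_eq_iff)
next
  case (Suc m)
  obtain f g where fg: "z = (f, g)" "f \<in> cochains scA scM n" "g \<in> cochains scA scM m"
    using z Suc by (cases z) (auto simp: pair_cochains_def)
  show ?thesis
    using Suc fg(1)
    by (simp add: rba_diff_def mrba_diff_def fun_eq_iff hochschild_diff_twisted[OF R S fg(3)]
        Psi_eq_Phi[OF R S fg(2), unfolded Suc] M.scale_right_diff_distrib)
qed

end

section \<open>Cohomology of isomorphic complexes\<close>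

text \<open>The induced map takes a coset to its image under \<open>h n\<close>. Injectivity on the
  whole type makes image-taking injective on sets and lets \<open>d n z = 0\<close> be tested after
  applying \<open>h (Suc n)\<close>.\<close>

lemma lin_isomorphic_cohomology:
  fixes h :: "nat \<Rightarrow> 'v::ab_group_add \<Rightarrow> 'w::ab_group_add"
  assumes inj: "\<And>n. inj (h n)"
    and add: "\<And>n x y. h n (x + y) = h n x + h n y"
    and scale: "\<And>n c x. h n (s c x) = s' c (h n x)"
    and onto: "\<And>n. h n ` C n = C' n"
    and comm: "\<And>n z. z \<in> C n \<Longrightarrow> h (Suc n) (d n z) = d' n (h n z)"
  shows "lin_isomorphic (cohomology s C d n) (cohomology s' C' d' n)"
proof -
  let ?B = "if n = 0 then {0} else d (n - 1) ` C (n - 1)"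
  let ?B' = "if n = 0 then {0} else d' (n - 1) ` C' (n - 1)"
  have zero: "h k 0 = 0" for k
    using add[of k 0 0] by simp
  have "h n ` d (n - 1) ` C (n - 1) = d' (n - 1) ` C' (n - 1)" if "n \<noteq> 0"
    using that comm[of _ "n - 1"] by (auto simp: onto[symmetric] image_image cong: image_cong)
  then have B: "h n ` ?B = ?B'"
    by (auto simp: zero)
  have "d' n (h n z) = 0 \<longleftrightarrow> d n z = 0" if "z \<in> C n" for z
    using comm[OF that] zero inj_eq[OF inj, of "Suc n" "d n z" 0] by simp
  then have Z: "h n ` {z \<in> C n. d n z = 0} = {z \<in> C' n. d' n z = 0}"
    by (auto simp: onto[symmetric])
  have plus: "h n ` (X + Y) = h n ` X + h n ` Y" for X Y
    by (auto elim!: set_plus_elim simp: add intro!: set_plus_intro) (auto simp flip: add intro: set_plus_intro)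
  have coset: "h n ` (z +o X) = h n z +o h n ` X" for z X
    using plus[of "{z}" X] by (simp add: set_plus_def elt_set_plus_def)
  have smult: "h n ` s c ` X = s' c ` h n ` X" for c X
    by (simp add: image_image scale)
  have "lin_iso (cohomology s C d n) (cohomology s' C' d' n) ((`) (h n))"
    unfolding lin_iso_def bij_betw_def
  proof (intro conjI ballI allI)
    show "inj_on ((`) (h n)) (vectors (cohomology s C d n))"
      using inj by (simp add: inj_on_def inj_image_eq_iff)
    show "(`) (h n) ` vectors (cohomology s C d n) = vectors (cohomology s' C' d' n)"
      by (simp add: cohomology_def quotient_space_def image_image coset B flip: Z)
  \<comment> \<open>Addition and scaling of cosets are operations on sets, and taking images
    commutes with them.\<close>
  qed (simp_all only: cohomology_def quotient_space_def lin_space.simps plus smult B)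
  then show ?thesis
    unfolding lin_isomorphic_def by blast
qed

lemma cochains_scaled:
  assumes "vector_space scM" "g \<in> cochains scA scM n"
  shows "(\<lambda>xs. scM c (g xs)) \<in> cochains scA scM n"
proof -
  interpret vector_space scM by fact
  show ?thesis
    using assms(2)
    by (auto simp: cochains_def Vector_Spaces.linear_iff scale_right_distrib mult.commute)
qed

section \<open>The isomorphism of the two complexes\<close>

theorem theorem3p4:
  fixes scA :: "'k::field_char_0 \<Rightarrow> 'a::ab_group_add \<Rightarrow> 'a"
    and mul :: "'a \<Rightarrow> 'a \<Rightarrow> 'a"
    and lam :: 'k
    and P R :: "'a \<Rightarrow> 'a"
    and scM :: "'k \<Rightarrow> 'm::ab_group_add \<Rightarrow> 'm"
    and lact :: "'a \<Rightarrow> 'm \<Rightarrow> 'm"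
    and ract :: "'m \<Rightarrow> 'a \<Rightarrow> 'm"
    and Q S :: "'m \<Rightarrow> 'm"
  assumes "rota_baxter_algebra scA mul lam P"
    and "rota_baxter_bimodule scA mul lam P scM lact ract Q"
    and "R = (\<lambda>a. scA lam a + scA 2 (P a))"
    and "S = (\<lambda>u. scM lam u + scM 2 (Q u))"
  shows "modified_rota_baxter_algebra scA mul (- (lam ^ 2)) R \<and>
    modified_rota_baxter_bimodule scA mul (- (lam ^ 2)) R scM lact ract S \<and>
    (\<forall>n. lin_isomorphic
           (rba_cohomology scA mul lam P scM lact ract Q n)
           (mrba_cohomology scA mul (- (lam ^ 2)) R scM lact ract S n))"
proof (intro conjI allI)
  interpret rota_baxter_bimodule scA mul lam P scM lact ract Q by fact
  show "modified_rota_baxter_algebra scA mul (- (lam ^ 2)) R"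
    by (rule modified_algebra) fact
  show "modified_rota_baxter_bimodule scA mul (- (lam ^ 2)) R scM lact ract S"
    by (rule modified_bimodule) fact+
  fix n
  \<comment> \<open>The truncated \<open>n - 1\<close> makes \<open>h 0\<close> the
    identity.\<close>
  define h :: "nat \<Rightarrow> ('a list \<Rightarrow> 'm) \<times> ('a list \<Rightarrow> 'm) \<Rightarrow> _"
    where "h n = map_prod id (\<lambda>g xs. scM (2 ^ (n - 1)) (g xs))" for n
  show "lin_isomorphic (rba_cohomology scA mul lam P scM lact ract Q n)
      (mrba_cohomology scA mul (- (lam ^ 2)) R scM lact ract S n)"
    unfolding rba_cohomology_def mrba_cohomology_def
  proof (rule lin_isomorphic_cohomology[where h = h])
    fix n
    show "inj (h n)"
      by (auto simp: inj_def h_def fun_eq_iff)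
    show "h n (x + y) = h n x + h n y" for x y
      by (cases x; cases y) (simp add: h_def fun_eq_iff M.scale_right_distrib)
    show "h n (pair_scale scM c x) = pair_scale scM c (h n x)" for c x
      by (cases x) (simp add: h_def pair_scale_def fun_eq_iff mult.commute)
    show "h n ` pair_cochains scA scM n = pair_cochains scA scM n"
    proof
      have scaled: "(\<lambda>xs. scM c (g xs)) \<in> cochains scA scM k" if "g \<in> cochains scA scM k" for g k c
        using M.vector_space_axioms that by (rule cochains_scaled)
      show "h n ` pair_cochains scA scM n \<subseteq> pair_cochains scA scM n"
        by (auto simp: pair_cochains_def h_def scaled fun_eq_iff)
      show "pair_cochains scA scM n \<subseteq> h n ` pair_cochains scA scM n"
      proof
        fix z assume z: "z \<in> pair_cochains scA scM n"
        obtain f g where fg: "z = (f, g)" by fastforce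
        \<comment> \<open>In characteristic 0 the scalar \<open>2 ^ (n - 1)\<close> is invertible,
          so the preimage is obtained by division.\<close>
        have "z = h n (f, \<lambda>xs. scM (inverse (2 ^ (n - 1))) (g xs))"
          by (simp add: fg h_def)
        moreover have "(f, \<lambda>xs. scM (inverse (2 ^ (n - 1))) (g xs)) \<in> pair_cochains scA scM n"
          using z by (auto simp: fg pair_cochains_def scaled fun_eq_iff)
        ultimately show "z \<in> h n ` pair_cochains scA scM n" by blast
      qed
    qed
    show "h (Suc n) (rba_diff scA mul lam P scM lact ract Q n z) =
        mrba_diff mul (- (lam ^ 2)) R scM lact ract S n (h n z)"
      if "z \<in> pair_cochains scA scM n" for z
      using differentials_intertwined[OF assms(3,4) that] by (simp add: h_def)
  qed
qed

end
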